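(* If $n$ is an odd integer with $n\geq 3$, then $\dim_f(K_2\Box C_n)=\frac{2n}{n+1}$.
   Context: $K_2$ is the complete graph on two vertices and $C_n$ the cycle on $n$ vertices. The cartesian product $G\Box H$ has vertex set $V(G)\times V(H)$, with $(u_1,v_1)$ adjacent to $(u_2,v_2)$ iff either $u_1=u_2$ and $v_1v_2\in E(H)$, or $v_1=v_2$ and $u_1u_2\in E(G)$. For vertices $x,y$ of a connected graph $G$, $R_G\{x,y\}$ is the set of vertices $z$ with $d_G(x,z)\neq d_G(y,z)$. A resolving function of $G$ is $f:V(G)\to[0,1]$ with $\sum_{z\in R_G\{x,y\}}f(z)\geq 1$ for all distinct $x,y$; $\dim_f(G)$ is the minimum of $\sum_{v\in V(G)}f(v)$ over all resolving functions $f$. *)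

theory Defs
  imports "Graph_Theory.Graph_Theory" "HOL-Library.FuncSet"
begin

text \<open>
  As in the Graph_Theory library, an undirected simple graph is a symmetric loop-free digraph
  (locale \<^locale>\<open>pair_graph\<close>): every edge is represented by its two arcs.
\<close>

definition complete_graph :: "nat \<Rightarrow> nat pair_pre_digraph" where
  "complete_graph n = \<lparr> pverts = {..<n}, parcs = {(u, v). u < n \<and> v < n \<and> u \<noteq> v} \<rparr>"

text \<open>A simple graph, and the cycle on \<open>n\<close> vertices, only for \<open>n \<ge> 3\<close>.\<close>

definition cycle_graph :: "nat \<Rightarrow> nat pair_pre_digraph" where
  "cycle_graph n = \<lparr> pverts = {..<n},
     parcs = {(u, v). u < n \<and> v < n \<and> (v = (u + 1) mod n \<or> u = (v + 1) mod n)} \<rparr>"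

definition cartesian_product ::
    "'a pair_pre_digraph \<Rightarrow> 'b pair_pre_digraph \<Rightarrow> ('a \<times> 'b) pair_pre_digraph" where
  "cartesian_product G H = \<lparr> pverts = pverts G \<times> pverts H,
     parcs = {((u1, v1), (u2, v2)).
       u1 \<in> pverts G \<and> u2 \<in> pverts G \<and> v1 \<in> pverts H \<and> v2 \<in> pverts H \<and>
       (u1 = u2 \<and> (v1, v2) \<in> parcs H \<or> v1 = v2 \<and> (u1, u2) \<in> parcs G)} \<rparr>"

text \<open>The library's shortest-path distance, with every arc of weight 1.\<close>

definition graph_dist :: "'a pair_pre_digraph \<Rightarrow> 'a \<Rightarrow> 'a \<Rightarrow> ereal" where
  "graph_dist G x y = wf_digraph.\<mu> (with_proj G) (\<lambda>_. 1) x y"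

definition resolving_set :: "'a pair_pre_digraph \<Rightarrow> 'a \<Rightarrow> 'a \<Rightarrow> 'a set" where
  "resolving_set G x y = {z \<in> pverts G. graph_dist G x z \<noteq> graph_dist G y z}"

definition resolving_function :: "'a pair_pre_digraph \<Rightarrow> ('a \<Rightarrow> real) \<Rightarrow> bool" where
  "resolving_function G f \<longleftrightarrow> f \<in> pverts G \<rightarrow> {0..1} \<and>
     (\<forall>x\<in>pverts G. \<forall>y\<in>pverts G. x \<noteq> y \<longrightarrow> (\<Sum>z\<in>resolving_set G x y. f z) \<ge> 1)"

text \<open>
  \<open>LEAST\<close> (unlike \<open>Inf\<close>) is a genuine minimum: it is unspecified if the infimum is not attained.
\<close>

definition fractional_dim :: "'a pair_pre_digraph \<Rightarrow> real" where
  "fractional_dim G = (LEAST s. \<exists>f. resolving_function G f \<and> s = (\<Sum>v\<in>pverts G. f v))"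

lemma complete_digraph_complete_graph: "complete_digraph n (with_proj (complete_graph n))"
  by (auto simp: complete_digraph_pair_def complete_graph_def)

lemma pair_graph_cycle_graph:
  assumes "n \<ge> 3"
  shows "pair_graph (cycle_graph n)"
proof
  show "finite (parcs (cycle_graph n))"
    by (rule finite_subset[of _ "{..<n} \<times> {..<n}"]) (auto simp: cycle_graph_def)
  show "fst e \<noteq> snd e" if "e \<in> parcs (cycle_graph n)" for e
    using that assms by (auto simp: cycle_graph_def mod_Suc split: if_splits)
qed (auto simp: cycle_graph_def symmetric_def intro!: symI)

lemma pair_graph_cartesian_product:
  assumes "pair_graph G" "pair_graph H"
  shows "pair_graph (cartesian_product G H)"
proof -
  interpret G: pair_graph G by fact
  interpret H: pair_graph H by fact
  show ?thesis
  proof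
    show "finite (parcs (cartesian_product G H))"
      by (rule finite_subset[of _ "(pverts G \<times> pverts H) \<times> (pverts G \<times> pverts H)"])
        (auto simp: cartesian_product_def)
    show "symmetric (with_proj (cartesian_product G H))"
      using G.sym_arcs H.sym_arcs
      by (auto simp: symmetric_def cartesian_product_def sym_def)
  qed (auto simp: cartesian_product_def dest: G.pair_no_loops H.pair_no_loops)
qed

end

theory Submission
  imports Defs
begin

text \<open>
  Write \<open>V\<close> for the \<open>2n\<close> vertices \<open>(a, k)\<close> of the prism. Since \<open>n\<close> is odd, any two distinct
  vertices \<open>i, j\<close> of the cycle have exactly one vertex \<open>k\<close> equidistant from both. For \<open>x = (0, i)\<close>
  and \<open>y = (1, j)\<close>, a fibre \<open>{(0, k), (1, k)}\<close> lies in \<open>R{x, y}\<close> when \<open>k\<close> is equidistant from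
  \<open>i\<close> and \<open>j\<close>, and otherwise at least one of its two vertices does. So \<open>R{x, y}\<close> has at least
  \<open>n + 1\<close> elements; for \<open>x, y\<close> in the same copy of the cycle it has \<open>2n - 2\<close>. Hence the constant function \<open>1 / (n + 1)\<close> is resolving.

  If \<open>j = i + 1\<close>, the distances from \<open>k\<close> to \<open>i\<close> and to \<open>j\<close> differ by exactly 1 for every \<open>k\<close>
  other than the antipode of the edge \<open>ij\<close>. Hence \<open>R{(0, i), (1, j)}\<close> and \<open>R{(1, i), (0, j)}\<close>
  together cover \<open>V\<close> once and the fibre over that antipode twice. Summing the two resolving
  inequalities over all edges of the cycle gives \<open>(n + 1) T \<ge> 2n\<close> for the total weight \<open>T\<close>.
\<close>

section \<open>Distance bounds from potential functions\<close>

context pair_wf_digraph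
begin

text \<open>Following arcs along which \<open>h\<close> drops by one must end in \<open>z\<close>,
  since \<open>h\<close> cannot drop forever; the walk obtained has at most \<open>h x\<close>
  arcs.\<close>

lemma graph_dist_le_potential:
  fixes h :: "'a \<Rightarrow> nat"
  assumes "\<And>x. x \<in> pverts G \<Longrightarrow> x \<noteq> z \<Longrightarrow> \<exists>y. (x, y) \<in> parcs G \<and> h x = Suc (h y)"
    and "x \<in> pverts G" "z \<in> pverts G"
  shows "graph_dist G x z \<le> ereal (real (h x))"
proof -
  have "\<exists>p. awalk x p z \<and> length p \<le> h x"
    using \<open>x \<in> pverts G\<close>
  proof (induction "h x" arbitrary: x rule: less_induct)
    case less
    show ?case
    proof (cases "x = z")
      case True
      then show ?thesis using \<open>z \<in> pverts G\<close> by (auto simp: awalk_Nil_iff intro!: exI[of _ "[]"])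
    next
      case False
      then obtain y where y: "(x, y) \<in> parcs G" "h x = Suc (h y)"
        using assms(1) less.prems by blast
      then have "y \<in> pverts G" by (auto dest: in_arcsD2)
      with less.hyps[of y] y obtain p where "awalk y p z" "length p \<le> h y" by auto
      then have "awalk x ((x, y) # p) z \<and> length ((x, y) # p) \<le> h x"
        using y by (auto simp: awalk_Cons_iff)
      then show ?thesis by blast
    qed
  qed
  then obtain p where p: "awalk x p z" "length p \<le> h x" by blast
  have "graph_dist G x z \<le> awalk_cost (\<lambda>_. 1) p"
    unfolding graph_dist_def by (rule min_cost_le_walk_cost[OF p(1)])
  also have "awalk_cost (\<lambda>_. 1) p = real (length p)"
    by (induction p) auto
  also have "ereal \<dots> \<le> real (h x)" using p by simp
  finally show ?thesis by simp
qed

text \<open>Each arc lowers \<open>h\<close> by at most one, so every walk from \<open>x\<close> to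
  \<open>z\<close> has at least \<open>h x\<close> arcs, and the distance is the infimum over
  walks.\<close>

lemma graph_dist_ge_potential:
  fixes h :: "'a \<Rightarrow> nat"
  assumes "\<And>x y. (x, y) \<in> parcs G \<Longrightarrow> h x \<le> Suc (h y)" and "h z = 0"
  shows "ereal (real (h x)) \<le> graph_dist G x z"
proof -
  have "real (h x) \<le> awalk_cost (\<lambda>_. 1) p" if "awalk x p z" for p
    using that
  proof (induction p arbitrary: x)
    case Nil
    then show ?case using assms(2) by (simp add: awalk_Nil_iff)
  next
    case (Cons e p)
    obtain u y where e: "e = (u, y)" by (cases e)
    with Cons.prems have "u = x" "(x, y) \<in> parcs G" "awalk y p z"
      by (auto simp: awalk_Cons_iff)
    then show ?case using Cons.IH[of y] assms(1)[of x y] e by auto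
  qed
  then show ?thesis
    unfolding graph_dist_def \<mu>_def by (auto intro!: INF_greatest)
qed

end

section \<open>Distances and equidistant vertices in the cycle\<close>

text \<open>On natural numbers, \<open>(i - j) + (j - i)\<close> is the absolute difference.\<close>

definition cycle_dist :: "nat \<Rightarrow> nat \<Rightarrow> nat \<Rightarrow> nat" where
  "cycle_dist n i j = min ((i - j) + (j - i)) (n - ((i - j) + (j - i)))"

text \<open>Over the integers truncated subtraction disappears, which makes the later case analyses
  linear arithmetic.\<close>

lemma int_cycle_dist:
  assumes "i < n" "j < n"
  shows "int (cycle_dist n i j) = min \<bar>int i - int j\<bar> (int n - \<bar>int i - int j\<bar>)"
proof -
  have "int ((i - j) + (j - i)) = \<bar>int i - int j\<bar>" "(i - j) + (j - i) \<le> n" using assms by linarith+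
  then show ?thesis by (simp only: cycle_dist_def of_nat_min of_nat_diff)
qed

lemma cycle_dist_self [simp]: "cycle_dist n i i = 0"
  by (simp add: cycle_dist_def)

lemma cycle_dist_succ:
  assumes "i < n" "k < n"
  shows "cycle_dist n i k \<le> Suc (cycle_dist n ((i + 1) mod n) k)"
    and "cycle_dist n ((i + 1) mod n) k \<le> Suc (cycle_dist n i k)"
proof -
  define s where "s = (i + 1) mod n"
  have s: "s < n" "i + 1 = n \<and> s = 0 \<or> s = i + 1" using assms by (auto simp: s_def mod_Suc)
  note * = int_cycle_dist[OF assms] int_cycle_dist[OF s(1) assms(2)]
  show "cycle_dist n i k \<le> Suc (cycle_dist n ((i + 1) mod n) k)"
    unfolding s_def[symmetric] using * s assms by linarith
  show "cycle_dist n ((i + 1) mod n) k \<le> Suc (cycle_dist n i k)"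
    unfolding s_def[symmetric] using * s assms by linarith
qed

text \<open>Of the two neighbours \<open>s\<close> and \<open>p\<close> of \<open>i\<close>, one
  lies on a shortest path to \<open>k\<close>.\<close>

lemma cycle_dist_descent:
  assumes "n \<ge> 3" "i < n" "k < n" "i \<noteq> k"
  shows "\<exists>j. (i, j) \<in> parcs (cycle_graph n) \<and> cycle_dist n i k = Suc (cycle_dist n j k)"
proof -
  define s p where "s = (if Suc i = n then 0 else Suc i)" and "p = (if i = 0 then n - 1 else i - 1)"
  have sp: "s < n" "p < n" "i + 1 = n \<and> s = 0 \<or> s = i + 1" "i = 0 \<and> p + 1 = n \<or> p + 1 = i"
    using assms by (auto simp: s_def p_def)
  have "(i, s) \<in> parcs (cycle_graph n)" "(i, p) \<in> parcs (cycle_graph n)"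
    using assms by (auto simp: cycle_graph_def s_def p_def mod_Suc)
  moreover have "cycle_dist n i k = Suc (cycle_dist n s k) \<or> cycle_dist n i k = Suc (cycle_dist n p k)"
  proof -
    define a b c d m where "a = int i" "b = int k" "c = int s" "d = int p" "m = int n"
    have "0 \<le> a" "0 \<le> b" "a < m" "b < m" "a \<noteq> b" "a + 1 = m \<and> c = 0 \<or> c = a + 1"
        "a = 0 \<and> d + 1 = m \<or> d + 1 = a"
      using assms sp by (auto simp: a_b_c_d_m_def)
    then have "min \<bar>a - b\<bar> (m - \<bar>a - b\<bar>) = 1 + min \<bar>c - b\<bar> (m - \<bar>c - b\<bar>) \<or>
        min \<bar>a - b\<bar> (m - \<bar>a - b\<bar>) = 1 + min \<bar>d - b\<bar> (m - \<bar>d - b\<bar>)"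
      by (smt (z3))
    then show ?thesis
      unfolding a_b_c_d_m_def int_cycle_dist[OF assms(2,3), symmetric]
        int_cycle_dist[OF sp(1) assms(3), symmetric] int_cycle_dist[OF sp(2) assms(3), symmetric]
      by linarith
  qed
  ultimately show ?thesis by blast
qed

text \<open>Equal distances mean that \<open>i - k\<close> and \<open>j - k\<close> agree up to sign
  modulo \<open>n\<close>. As \<open>i \<noteq> j\<close>, the signs are opposite, so
  \<open>2 * k\<close> is congruent to \<open>i + j\<close>; the ranges leave only the multiples 0
  and \<plusminus>\<open>n\<close>.\<close>

lemma cycle_dist_eq_iff:
  assumes "i < n" "j < n" "i \<noteq> j" "k < n"
  shows "cycle_dist n i k = cycle_dist n j k \<longleftrightarrow>
    2 * k = i + j \<or> 2 * k = i + j + n \<or> 2 * k + n = i + j"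
proof -
  define a b c m where "a = int i" "b = int j" "c = int k" "m = int n"
  have "0 \<le> a" "0 \<le> b" "0 \<le> c" "a < m" "b < m" "c < m" "a \<noteq> b"
    using assms by (auto simp: a_b_c_m_def)
  then have "min \<bar>a - c\<bar> (m - \<bar>a - c\<bar>) = min \<bar>b - c\<bar> (m - \<bar>b - c\<bar>) \<longleftrightarrow>
      2 * c = a + b \<or> 2 * c = a + b + m \<or> 2 * c + m = a + b"
    by (smt (z3))
  then show ?thesis
    unfolding a_b_c_m_def int_cycle_dist[OF assms(1,4), symmetric] int_cycle_dist[OF assms(2,4), symmetric]
    by linarith
qed

text \<open>Modulo an odd \<open>n\<close>, doubling is injective: parity excludes a difference of
  \<open>n\<close> between \<open>2 * k\<close> and \<open>2 * l\<close>, and the range excludes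
  \<open>2 * n\<close>.\<close>

lemma cycle_dist_eq_unique:
  assumes "odd n" "i < n" "j < n" "i \<noteq> j" "k < n" "l < n"
    and "cycle_dist n i k = cycle_dist n j k" "cycle_dist n i l = cycle_dist n j l"
  shows "k = l"
proof -
  have "2 * k = i + j \<or> 2 * k = i + j + n \<or> 2 * k + n = i + j"
      "2 * l = i + j \<or> 2 * l = i + j + n \<or> 2 * l + n = i + j"
    using assms cycle_dist_eq_iff by blast+
  then have "2 * k = 2 * l \<or> 2 * k = 2 * l + n \<or> 2 * l = 2 * k + n \<or>
      2 * k = 2 * l + 2 * n \<or> 2 * l = 2 * k + 2 * n"
    by auto
  moreover have "2 * k \<noteq> 2 * l + n" "2 * l \<noteq> 2 * k + n"
    using \<open>odd n\<close> by (metis even_add even_mult_iff even_numeral)+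
  ultimately show ?thesis using \<open>k < n\<close> \<open>l < n\<close> by auto
qed

lemma cycle_dist_eq_exists:
  assumes "odd n" "i < n" "j < n"
  shows "\<exists>k<n. cycle_dist n i k = cycle_dist n j k"
proof (cases "i = j")
  case False
  \<comment> \<open>As \<open>n\<close> is odd, either \<open>i + j\<close> or both of
    \<open>i + j + n\<close> and \<open>i + j - n\<close> are even; the witness halves one that
    lands in range.\<close>
  have "\<exists>k<n. 2 * k = i + j \<or> 2 * k = i + j + n \<or> 2 * k + n = i + j"
  proof (cases "even (i + j)")
    case True
    with assms show ?thesis by (intro exI[of _ "(i + j) div 2"]) auto
  next
    case odd_sum: False
    show ?thesis
    proof (cases "i + j < n")
      case True
      with assms odd_sum show ?thesis by (intro exI[of _ "(i + j + n) div 2"]) auto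
    next
      case False
      with assms odd_sum show ?thesis by (intro exI[of _ "(i + j - n) div 2"]) auto
    qed
  qed
  then show ?thesis using cycle_dist_eq_iff assms(2,3) False by blast
qed (use assms in auto)

text \<open>Since \<open>(n + 1) div 2\<close> is the inverse of 2 modulo \<open>n\<close>, doubling
  \<open>k\<close> gives \<open>i + (i + 1)\<close> modulo \<open>n\<close>: \<open>k\<close> is the
  antipode of the edge.\<close>

lemma cycle_dist_eq_succ:
  assumes "odd n" "i < n"
  defines "k \<equiv> (i + (n + 1) div 2) mod n"
  shows "cycle_dist n i k = cycle_dist n ((i + 1) mod n) k"
proof -
  obtain m where n: "n = 2 * m + 1" using \<open>odd n\<close> by (rule oddE)
  have k: "k = (if i < m then i + m + 1 else i - m)"
    using assms(2) by (auto simp: k_def n mod_if)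
  define s where "s = (i + 1) mod n"
  have s: "s < n" "i + 1 = n \<and> s = 0 \<or> s = i + 1"
    using assms(2) by (auto simp: s_def mod_Suc)
  have "k < n" using k n assms(2) by auto
  show ?thesis
  \<comment> \<open>The vertex \<open>i\<close> is its own successor only for
    \<open>n = 1\<close>.\<close>
  proof (cases "i = s")
    case False
    have "2 * k = i + s \<or> 2 * k = i + s + n \<or> 2 * k + n = i + s"
      using s(2) k n by auto
    then show ?thesis
      unfolding s_def[symmetric] using cycle_dist_eq_iff[OF assms(2) s(1) False \<open>k < n\<close>] by simp
  qed (simp add: s_def)
qed

section \<open>Distances and resolving sets in the prism\<close>

abbreviation prism_graph :: "nat \<Rightarrow> (nat \<times> nat) pair_pre_digraph" where
  "prism_graph n \<equiv> cartesian_product (complete_graph 2) (cycle_graph n)"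

text \<open>Distances add over the factors of a cartesian product; the first summand is the distance
  in \<open>K_2\<close>.\<close>

definition prism_dist :: "nat \<Rightarrow> nat \<times> nat \<Rightarrow> nat \<times> nat \<Rightarrow> nat" where
  "prism_dist n x y = (if fst x = fst y then 0 else 1) + cycle_dist n (snd x) (snd y)"

lemma pverts_prism_graph: "pverts (prism_graph n) = {0, 1} \<times> {..<n}"
  by (auto simp: cartesian_product_def complete_graph_def cycle_graph_def)

lemma pair_graph_prism_graph:
  assumes "n \<ge> 3"
  shows "pair_graph (prism_graph n)"
proof (rule pair_graph_cartesian_product[OF _ pair_graph_cycle_graph[OF assms]])
  show "pair_graph (complete_graph 2)"
    by unfold_locales (auto simp: complete_graph_def symmetric_def
        intro: symI finite_subset[of _ "{..<2} \<times> {..<2}"])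
qed

text \<open>The distance formula is a potential for both bounds. To descend, change to the copy of
  \<open>z\<close> if necessary, and otherwise move along the cycle.\<close>

lemma graph_dist_prism_graph:
  assumes "n \<ge> 3" "x \<in> pverts (prism_graph n)" "z \<in> pverts (prism_graph n)"
  shows "graph_dist (prism_graph n) x z = ereal (real (prism_dist n x z))"
proof -
  interpret pair_graph "prism_graph n" using assms(1) by (rule pair_graph_prism_graph)
  obtain c k where z: "z = (c, k)" "c < 2" "k < n"
    using assms(3) by (auto simp: pverts_prism_graph)
  show ?thesis
  proof (rule antisym)
    show "graph_dist (prism_graph n) x z \<le> ereal (real (prism_dist n x z))"
    proof (rule graph_dist_le_potential[OF _ assms(2,3)])
      fix y assume y: "y \<in> pverts (prism_graph n)" "y \<noteq> z"
      obtain a i where ai: "y = (a, i)" "a < 2" "i < n"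
        using y(1) by (auto simp: pverts_prism_graph)
      show "\<exists>w. (y, w) \<in> parcs (prism_graph n) \<and> prism_dist n y z = Suc (prism_dist n w z)"
      proof (cases "a = c")
        case True
        with y ai z have "i \<noteq> k" by auto
        from cycle_dist_descent[OF assms(1) ai(3) z(3) this] obtain j
          where j: "(i, j) \<in> parcs (cycle_graph n)" "cycle_dist n i k = Suc (cycle_dist n j k)"
          by blast
        then show ?thesis using ai z True
          by (intro exI[of _ "(a, j)"])
            (auto simp: prism_dist_def cartesian_product_def complete_graph_def cycle_graph_def)
      next
        case False
        then show ?thesis using ai z
          by (intro exI[of _ "(c, i)"])
            (auto simp: prism_dist_def cartesian_product_def complete_graph_def cycle_graph_def)
      qed
    qed
    show "ereal (real (prism_dist n x z)) \<le> graph_dist (prism_graph n) x z"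
    proof (rule graph_dist_ge_potential)
      show "prism_dist n y z \<le> Suc (prism_dist n w z)" if "(y, w) \<in> parcs (prism_graph n)" for y w
        using that z(3) cycle_dist_succ[of "snd y" n k] cycle_dist_succ[of "snd w" n k]
        by (auto simp: z(1) prism_dist_def cartesian_product_def cycle_graph_def)
    qed (simp add: prism_dist_def)
  qed
qed

lemma resolving_set_prism_graph:
  assumes "n \<ge> 3" "x \<in> pverts (prism_graph n)" "y \<in> pverts (prism_graph n)"
  shows "resolving_set (prism_graph n) x y =
    {z \<in> pverts (prism_graph n). prism_dist n x z \<noteq> prism_dist n y z}"
  using assms by (auto simp: resolving_set_def graph_dist_prism_graph)

lemma sum_pverts_prism_graph:
  fixes g :: "nat \<times> nat \<Rightarrow> real"
  shows "(\<Sum>z\<in>pverts (prism_graph n). g z) = (\<Sum>k<n. g (0, k) + g (1, k))"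
proof -
  have "(\<Sum>z\<in>pverts (prism_graph n). g z) = (\<Sum>a\<in>{0,1}. \<Sum>k<n. g (a, k))"
    unfolding pverts_prism_graph by (simp only: sum.cartesian_product case_prod_eta)
  also have "\<dots> = (\<Sum>k<n. g (0, k) + g (1, k))"
    by (simp add: sum.distrib)
  finally show ?thesis .
qed

lemma sum_resolving_set_prism_graph:
  fixes f :: "nat \<times> nat \<Rightarrow> real"
  assumes "n \<ge> 3" "x \<in> pverts (prism_graph n)" "y \<in> pverts (prism_graph n)"
  shows "(\<Sum>z\<in>resolving_set (prism_graph n) x y. f z) =
    (\<Sum>k<n. (if prism_dist n x (0, k) \<noteq> prism_dist n y (0, k) then f (0, k) else 0) +
      (if prism_dist n x (1, k) \<noteq> prism_dist n y (1, k) then f (1, k) else 0))"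
proof -
  have "finite (pverts (prism_graph n))" by (simp add: pverts_prism_graph)
  then have "(\<Sum>z\<in>resolving_set (prism_graph n) x y. f z) = (\<Sum>z\<in>pverts (prism_graph n).
      if prism_dist n x z \<noteq> prism_dist n y z then f z else 0)"
    unfolding resolving_set_prism_graph[OF assms] by (rule sum.inter_filter)
  then show ?thesis by (simp only: sum_pverts_prism_graph)
qed

section \<open>Upper bound\<close>

lemma resolving_function_prism_graph_const:
  assumes "odd n" "n \<ge> 3"
  shows "resolving_function (prism_graph n) (\<lambda>_. 1 / (real n + 1))"
  unfolding resolving_function_def
proof (intro conjI ballI impI)
  show "(\<lambda>_. 1 / (real n + 1)) \<in> pverts (prism_graph n) \<rightarrow> {0..1}" by simp
next
  fix x y assume xy: "x \<in> pverts (prism_graph n)" "y \<in> pverts (prism_graph n)" "x \<noteq> y"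
  define r where "r = 1 / (real n + 1)"
  have r: "r > 0" "(real n + 1) * r = 1" by (simp_all add: r_def field_simps)
  obtain a i where x: "x = (a, i)" "a < 2" "i < n"
    using xy(1) by (auto simp: pverts_prism_graph)
  obtain b j where y: "y = (b, j)" "b < 2" "j < n"
    using xy(2) by (auto simp: pverts_prism_graph)
  define S where "S k = (if prism_dist n x (0, k) \<noteq> prism_dist n y (0, k) then r else 0) +
      (if prism_dist n x (1, k) \<noteq> prism_dist n y (1, k) then r else 0)" for k
  \<comment> \<open>If \<open>i = j\<close>, every vertex of the cycle is equidistant and any choice
    of \<open>l\<close> serves.\<close>
  obtain l where l: "l < n" "cycle_dist n i l = cycle_dist n j l"
    using cycle_dist_eq_exists[OF assms(1) x(3) y(3)] by blast
  have split: "(\<Sum>k<n. S k) = S l + (\<Sum>k\<in>{..<n} - {l}. S k)"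
    using l by (simp add: sum.remove)
  have card: "real (card ({..<n} - {l})) = real n - 1"
    using l assms(2) by simp
  have "(real n + 1) * r \<le> (\<Sum>k<n. S k)"
  proof (cases "a = b")
    case True
    with xy x y have "i \<noteq> j" by auto
    have "S k \<ge> 2 * r" if "k \<in> {..<n} - {l}" for k
    proof -
      have "cycle_dist n i k \<noteq> cycle_dist n j k"
        using cycle_dist_eq_unique[OF assms(1) x(3) y(3) \<open>i \<noteq> j\<close> _ l(1) _ l(2)] that by auto
      then show ?thesis using True by (simp add: S_def x y prism_dist_def)
    qed
    then have "(\<Sum>k\<in>{..<n} - {l}. S k) \<ge> of_nat (card ({..<n} - {l})) * (2 * r)"
      by (rule sum_bounded_below)
    moreover have "S l \<ge> 0" using r by (simp add: S_def)
    \<comment> \<open>Here \<open>n \<ge> 3\<close> enters, as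
      \<open>n + 1 \<le> 2 * (n - 1)\<close>.\<close>
    moreover have "(real n + 1) * r \<le> (real n - 1) * 2 * r"
      using assms(2) r(1) by (intro mult_right_mono) auto
    ultimately show ?thesis unfolding split card by linarith
  next
    case False
    then have ab: "a = 0 \<and> b = 1 \<or> a = 1 \<and> b = 0" using x y by auto
    \<comment> \<open>With \<open>d\<close> and \<open>e\<close> the distances from \<open>k\<close>
      to \<open>i\<close> and \<open>j\<close>, the equations \<open>d = e + 1\<close> and
      \<open>d + 1 = e\<close> cannot both hold, so some vertex of the fibre is resolved.\<close>
    have "S k \<ge> r" if "k \<in> {..<n} - {l}" for k
      using r ab by (auto simp: S_def x y prism_dist_def)
    then have "(\<Sum>k\<in>{..<n} - {l}. S k) \<ge> of_nat (card ({..<n} - {l})) * r"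
      by (rule sum_bounded_below)
    \<comment> \<open>Over \<open>l\<close> both vertices are resolved, which raises the count from
      \<open>n\<close> to \<open>n + 1\<close>.\<close>
    moreover have "S l = 2 * r"
      using ab l by (auto simp: S_def x y prism_dist_def)
    ultimately show ?thesis unfolding split card by (simp add: algebra_simps)
  qed
  then show "(\<Sum>z\<in>resolving_set (prism_graph n) x y. 1 / (real n + 1)) \<ge> 1"
    unfolding sum_resolving_set_prism_graph[OF assms(2) xy(1,2)] r(2) S_def unfolding r_def .
qed

section \<open>Lower bound\<close>

lemma bij_betw_add_mod:
  fixes n c :: nat
  assumes "n > 0"
  shows "bij_betw (\<lambda>i. (i + c) mod n) {..<n} {..<n}"
proof -
  have "inj_on (\<lambda>i. (i + c) mod n) {..<n}"
  proof (rule inj_onI)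
    fix x y assume xy: "x \<in> {..<n}" "y \<in> {..<n}" "(x + c) mod n = (y + c) mod n"
    then obtain q r where "x + n * q = y + n * r" by (auto simp: nat_mod_eq_iff)
    then have "(x + n * q) mod n = (y + n * r) mod n" by (rule arg_cong)
    then show "x = y" using xy(1,2) by simp
  qed
  moreover from this have "(\<lambda>i. (i + c) mod n) ` {..<n} = {..<n}"
    using assms by (intro endo_inj_surj) auto
  ultimately show ?thesis by (simp add: bij_betw_def)
qed

lemma resolving_function_prism_graph_sum_ge:
  assumes "odd n" "n \<ge> 3" and f: "resolving_function (prism_graph n) f"
  shows "2 * real n / (real n + 1) \<le> (\<Sum>v\<in>pverts (prism_graph n). f v)"
proof -
  define F where "F k = f (0, k) + f (1, k)" for k
  define T where "T = (\<Sum>k<n. F k)"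
  have T: "(\<Sum>v\<in>pverts (prism_graph n). f v) = T"
    by (simp add: sum_pverts_prism_graph T_def F_def)
  have bound: "2 \<le> T + F ((i + (n + 1) div 2) mod n)" if "i < n" for i
  proof -
    define j l where "j = (i + 1) mod n" and "l = (i + (n + 1) div 2) mod n"
    have j: "j < n" "i \<noteq> j" using that assms(2) by (auto simp: j_def mod_Suc)
    have l: "l < n" "cycle_dist n i l = cycle_dist n j l"
      using cycle_dist_eq_succ[OF assms(1) that] assms(2) by (auto simp: j_def l_def)
    have ij: "cycle_dist n i k = Suc (cycle_dist n j k) \<or> cycle_dist n j k = Suc (cycle_dist n i k)"
      if k: "k < n" "k \<noteq> l" for k
    proof -
      have "cycle_dist n i k \<noteq> cycle_dist n j k"
        using cycle_dist_eq_unique[OF assms(1) \<open>i < n\<close> j k(1) l(1) _ l(2)] k(2) by blast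
      then show ?thesis
        using cycle_dist_succ[OF \<open>i < n\<close> k(1)] unfolding j_def by linarith
    qed
    let ?R = "\<lambda>x y. \<Sum>z\<in>resolving_set (prism_graph n) x y. f z"
    have V: "(0, i) \<in> pverts (prism_graph n)" "(1, i) \<in> pverts (prism_graph n)"
        "(0, j) \<in> pverts (prism_graph n)" "(1, j) \<in> pverts (prism_graph n)"
      using \<open>i < n\<close> j by (auto simp: pverts_prism_graph)
    have "2 \<le> ?R (0, i) (1, j) + ?R (1, i) (0, j)"
    proof -
      have "1 \<le> ?R (0, i) (1, j)" "1 \<le> ?R (1, i) (0, j)"
        using f V unfolding resolving_function_def by auto
      then show ?thesis by linarith
    qed
    also have "\<dots> = (\<Sum>k<n. F k + (if k = l then F k else 0))"
      unfolding sum_resolving_set_prism_graph[OF assms(2) V(1,4)]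
        sum_resolving_set_prism_graph[OF assms(2) V(2,3)] sum.distrib[symmetric]
    proof (rule sum.cong[OF refl])
      fix k assume "k \<in> {..<n}"
      then show "(if prism_dist n (0, i) (0, k) \<noteq> prism_dist n (1, j) (0, k) then f (0, k) else 0) +
          (if prism_dist n (0, i) (1, k) \<noteq> prism_dist n (1, j) (1, k) then f (1, k) else 0) +
          ((if prism_dist n (1, i) (0, k) \<noteq> prism_dist n (0, j) (0, k) then f (0, k) else 0) +
          (if prism_dist n (1, i) (1, k) \<noteq> prism_dist n (0, j) (1, k) then f (1, k) else 0)) =
          F k + (if k = l then F k else 0)"
        \<comment> \<open>Off the antipode each of the two pairs resolves exactly one vertex of the
          fibre, and not the same one; over \<open>l\<close> both pairs resolve both
          vertices.\<close>
        using ij[of k] l by (cases "k = l") (auto simp: prism_dist_def F_def)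
    qed
    also have "\<dots> = T + F l"
      using l by (simp add: sum.distrib T_def)
    finally show ?thesis by (simp add: l_def)
  qed
  have "2 * real n = (\<Sum>i<n. 2)" by simp
  also have "\<dots> \<le> (\<Sum>i<n. T + F ((i + (n + 1) div 2) mod n))"
    using bound by (intro sum_mono) auto
  also have "\<dots> = real n * T + (\<Sum>i<n. F ((i + (n + 1) div 2) mod n))"
    by (simp add: sum.distrib)
  \<comment> \<open>Each vertex of the cycle is the antipode of exactly one edge, so the extra
    fibres add up to one more \<open>T\<close>.\<close>
  also have "(\<Sum>i<n. F ((i + (n + 1) div 2) mod n)) = T"
    unfolding T_def using assms(2) by (intro sum.reindex_bij_betw bij_betw_add_mod) simp
  finally show ?thesis unfolding T by (simp add: field_simps)
qed

theorem theorem2p3: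
  fixes n :: nat
  assumes "odd n" and "n \<ge> 3"
  shows "fractional_dim (cartesian_product (complete_graph 2) (cycle_graph n))
    = 2 * real n / (real n + 1)"
  unfolding fractional_dim_def
proof (rule Least_equality)
  have "2 * real n / (real n + 1) = (\<Sum>v\<in>pverts (prism_graph n). 1 / (real n + 1))"
    by (simp add: pverts_prism_graph card_cartesian_product)
  then show "\<exists>f. resolving_function (prism_graph n) f \<and>
      2 * real n / (real n + 1) = (\<Sum>v\<in>pverts (prism_graph n). f v)"
    using resolving_function_prism_graph_const[OF assms] by blast
qed (use resolving_function_prism_graph_sum_ge[OF assms] in auto)

end
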